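(* Let $\gamma\in\mathbb{R}^n$ be a dual vector, and for a threshold $\rho\ge 0$ let $H_\rho=\frac1\eta\left(\mathrm{diag}(P_\rho^\top a)-P_\rho^\top\,\mathrm{diag}(a)\,P_\rho\right)\in\mathbb{R}^{n\times n}$ be the sparsified Hessian built from $P=P^k(\gamma)$ by the sparsification procedure. Then $H_\rho$ is symmetric and positive semidefinite, and its kernel satisfies $\ker(H_\rho)=\mathrm{span}\{\mathbf 1_n\}$, for all $\rho\geq 0$.
   Context: Data: positive integers $m,n$, a cost matrix $C\in\mathbb{R}^{m\times n}$ with nonnegative entries, vectors $a\in\mathbb{R}^m$, $b\in\mathbb{R}^n$ with strictly positive entries and $\sum_i a_i=\sum_j b_j=1$, a parameter $\eta>0$, and a matrix $X^k\in\mathbb{R}^{m\times n}$ with strictly positive entries (the current outer iterate of an iterative scheme started at $X^0=ab^\top$). $\mathbf 1_n$ is the all-ones vector in $\mathbb{R}^n$. For $\gamma\in\mathbb{R}^n$, $P=P^k(\gamma)\in\mathbb{R}^{m\times n}$ has entries $$P_{ij}=\frac{X^k_{ij}\exp((\gamma_j-C_{ij})/\eta)}{\sum_{l=1}^n X^k_{il}\exp((\gamma_l-C_{il})/\eta)}.$$ Sparsification procedure: let $i^\star=\arg\max_{i}a_i$. For a threshold $\rho\ge0$ define $P_\rho\in\mathbb{R}^{m\times n}$ by $$[P_\rho]_{ij}=\frac{P_{ij}\mathbf 1_{\{P_{ij}\ge\rho\}}}{\sum_{l=1}^n P_{il}\mathbf 1_{\{P_{il}\ge\rho\}}}\quad (i\ne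 i^\star),\qquad [P_\rho]_{i^\star j}=P_{i^\star j}.$$ *)

theory Defs
  imports "HOL-Analysis.Analysis"
begin

text \<open>An \<open>m\<times>n\<close> matrix is a \<open>real ^ 'n ^ 'm\<close>: \<open>A $ i $ j\<close> is the entry in row \<open>i\<close>, column \<open>j\<close>.\<close>

definition diag_mat :: "real ^ 'n \<Rightarrow> real ^ 'n ^ 'n" where
  "diag_mat v = (\<chi> i j. if i = j then v $ i else 0)"

definition psd :: "real ^ 'n ^ 'n \<Rightarrow> bool" where
  "psd A \<longleftrightarrow> (\<forall>x. 0 \<le> x \<bullet> (A *v x))"

definition mat_kernel :: "real ^ 'n ^ 'm \<Rightarrow> (real ^ 'n) set" where
  "mat_kernel A = {x. A *v x = 0}"

text \<open>The matrix \<open>P\<^sup>k(\<gamma>)\<close>, where \<open>X\<close> stands for the current outer iterate \<open>X\<^sup>k\<close>.\<close>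

definition plan ::
    "real ^ 'n ^ 'm \<Rightarrow> real ^ 'n ^ 'm \<Rightarrow> real \<Rightarrow> real ^ 'n \<Rightarrow> real ^ 'n ^ 'm" where
  "plan C X \<eta> \<gamma> = (\<chi> i j.
     X $ i $ j * exp ((\<gamma> $ j - C $ i $ j) / \<eta>) /
     (\<Sum>l\<in>UNIV. X $ i $ l * exp ((\<gamma> $ l - C $ i $ l) / \<eta>)))"

text \<open>If every entry of a row \<open>i \<noteq> i\<^sub>0\<close> lies below the threshold, the quotient is \<open>0 / 0\<close>; by the
  HOL convention \<open>0 / 0 = 0\<close> the sparsified row is then the zero row.\<close>

definition sparsify :: "'m \<Rightarrow> real \<Rightarrow> real ^ 'n ^ 'm \<Rightarrow> real ^ 'n ^ 'm" where
  "sparsify i\<^sub>0 \<rho> P = (\<chi> i j.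
     if i = i\<^sub>0 then P $ i $ j
     else P $ i $ j * of_bool (P $ i $ j \<ge> \<rho>) /
          (\<Sum>l\<in>UNIV. P $ i $ l * of_bool (P $ i $ l \<ge> \<rho>)))"

definition hessian :: "real \<Rightarrow> real ^ 'm \<Rightarrow> real ^ 'n ^ 'm \<Rightarrow> real ^ 'n ^ 'n" where
  "hessian \<eta> a Q = (1 / \<eta>) *\<^sub>R
     (diag_mat (transpose Q *v a) - transpose Q ** diag_mat a ** Q)"

end

theory Submission
  imports Defs
begin

text \<open>Write \<open>Q\<close> for the sparsified matrix and \<open>\<mu>\<^sub>i = (Q x)\<^sub>i\<close>. Each row of \<open>Q\<close> is either a
  probability vector or zero, so \<open>\<eta> x\<^sup>T H x = \<Sum>\<^sub>i a\<^sub>i \<Sum>\<^sub>j Q\<^sub>i\<^sub>j (x\<^sub>j - \<mu>\<^sub>i)\<^sup>2\<close> is a weighted sum of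
  variances. This gives positive semidefiniteness; and since row \<open>i\<^sub>0\<close> is kept unsparsified, hence
  positive, the form vanishes only if every \<open>x\<^sub>j\<close> equals \<open>\<mu>\<close> at \<open>i\<^sub>0\<close>.\<close>

lemma hessian_nth:
  "hessian \<eta> a Q $ j $ k =
    ((if j = k then \<Sum>i\<in>UNIV. a $ i * Q $ i $ j else 0)
      - (\<Sum>i\<in>UNIV. a $ i * Q $ i $ j * Q $ i $ k)) / \<eta>"
proof -
  have "(transpose Q ** diag_mat a ** Q) $ j $ k = (\<Sum>i\<in>UNIV. a $ i * Q $ i $ j * Q $ i $ k)"
    by (simp add: matrix_matrix_mult_def transpose_def diag_mat_def if_distrib sum.delta'
        mult.commute cong: if_cong)
  then show ?thesis
    by (simp add: hessian_def diag_mat_def matrix_vector_mult_def transpose_def mult.commute)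
qed

lemma transpose_hessian: "transpose (hessian \<eta> a Q) = hessian \<eta> a Q"
  by (simp add: vec_eq_iff transpose_def hessian_nth mult.commute mult.left_commute)

text \<open>Collecting the terms by row of \<open>Q\<close> exposes the deviation of
  \<open>x $ j\<close> from the row average. The form serves both the variance identity and the
  inclusion of the constant vectors in the kernel.\<close>

lemma hessian_mult_nth:
  "(hessian \<eta> a Q *v x) $ j = (\<Sum>i\<in>UNIV. a $ i * Q $ i $ j * (x $ j - (Q *v x) $ i)) / \<eta>"
proof -
  have "(hessian \<eta> a Q *v x) $ j =
      (\<Sum>k\<in>UNIV. (if j = k then \<Sum>i\<in>UNIV. a $ i * Q $ i $ j else 0) * x $ k
        - (\<Sum>i\<in>UNIV. a $ i * Q $ i $ j * Q $ i $ k * x $ k)) / \<eta>"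
    by (simp add: matrix_vector_mult_def hessian_nth sum_divide_distrib left_diff_distrib
        sum_distrib_right)
  also have "\<dots> = ((\<Sum>i\<in>UNIV. a $ i * Q $ i $ j) * x $ j
      - (\<Sum>k\<in>UNIV. \<Sum>i\<in>UNIV. a $ i * Q $ i $ j * Q $ i $ k * x $ k)) / \<eta>"
    by (simp add: sum_subtractf if_distrib[of "\<lambda>t. t * _"] cong: if_cong)
  \<comment> \<open>Once the sums are exchanged, the inner sum over \<open>k\<close> is the entry of
    \<open>Q *v x\<close> at \<open>i\<close>.\<close>
  also have "(\<Sum>k\<in>UNIV. \<Sum>i\<in>UNIV. a $ i * Q $ i $ j * Q $ i $ k * x $ k) =
      (\<Sum>i\<in>UNIV. a $ i * Q $ i $ j * (Q *v x) $ i)"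
    by (subst sum.swap) (simp add: matrix_vector_mult_def sum_distrib_left mult.assoc)
  finally show ?thesis
    by (simp add: sum_distrib_right right_diff_distrib sum_subtractf)
qed

lemma inner_hessian:
  assumes row: "\<And>i. (\<forall>j. Q $ i $ j = 0) \<or> (\<Sum>j\<in>UNIV. Q $ i $ j) = 1"
  shows "x \<bullet> (hessian \<eta> a Q *v x) =
    (\<Sum>i\<in>UNIV. a $ i * (\<Sum>j\<in>UNIV. Q $ i $ j * (x $ j - (Q *v x) $ i)\<^sup>2)) / \<eta>"
proof -
  define \<mu> where "\<mu> i = (Q *v x) $ i" for i
  \<comment> \<open>In a row of sum one, subtracting the mean leaves total deviation zero; in a zero
    row every term vanishes.\<close>
  have centred: "(\<Sum>j\<in>UNIV. Q $ i $ j * (x $ j - \<mu> i)) = 0" for i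
    using row[of i] by (auto simp: \<mu>_def matrix_vector_mult_def right_diff_distrib sum_subtractf
        simp flip: sum_distrib_right)
  have variance: "(\<Sum>j\<in>UNIV. Q $ i $ j * (x $ j - \<mu> i) * x $ j) =
      (\<Sum>j\<in>UNIV. Q $ i $ j * (x $ j - \<mu> i)\<^sup>2)" for i
  proof -
    \<comment> \<open>Split the last factor as \<open>x $ j = (x $ j - \<mu> i) + \<mu> i\<close>;
      the cross term is a multiple of the sum in \<open>centred\<close>.\<close>
    have "(\<Sum>j\<in>UNIV. Q $ i $ j * (x $ j - \<mu> i) * x $ j) =
        (\<Sum>j\<in>UNIV. Q $ i $ j * (x $ j - \<mu> i)\<^sup>2 + Q $ i $ j * (x $ j - \<mu> i) * \<mu> i)"
      by (intro sum.cong) (auto simp: algebra_simps power2_eq_square)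
    then show ?thesis
      using centred[of i] by (simp add: sum.distrib flip: sum_distrib_right)
  qed
  have "x \<bullet> (hessian \<eta> a Q *v x) =
      (\<Sum>j\<in>UNIV. \<Sum>i\<in>UNIV. a $ i * (Q $ i $ j * (x $ j - \<mu> i) * x $ j)) / \<eta>"
    by (simp add: inner_vec_def hessian_mult_nth \<mu>_def sum_divide_distrib sum_distrib_left ac_simps)
  also have "\<dots> = (\<Sum>i\<in>UNIV. a $ i * (\<Sum>j\<in>UNIV. Q $ i $ j * (x $ j - \<mu> i) * x $ j)) / \<eta>"
    by (subst sum.swap) (simp add: sum_distrib_left)
  finally show ?thesis by (simp add: variance) (simp add: \<mu>_def)
qed

lemma psd_hessian:
  assumes "0 < \<eta>" and "\<And>i. 0 \<le> a $ i" and "\<And>i j. 0 \<le> Q $ i $ j"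
    and "\<And>i. (\<forall>j. Q $ i $ j = 0) \<or> (\<Sum>j\<in>UNIV. Q $ i $ j) = 1"
  shows "psd (hessian \<eta> a Q)"
  using assms
  by (auto simp: psd_def inner_hessian intro!: divide_nonneg_pos sum_nonneg mult_nonneg_nonneg)

lemma mat_kernel_hessian:
  fixes Q :: "real ^ 'n ^ 'm"
  assumes \<eta>: "0 < \<eta>" and a: "\<And>i. 0 < a $ i" and Q: "\<And>i j. 0 \<le> Q $ i $ j"
    and row: "\<And>i. (\<forall>j. Q $ i $ j = 0) \<or> (\<Sum>j\<in>UNIV. Q $ i $ j) = 1"
    and pos: "\<And>j. 0 < Q $ i\<^sub>0 $ j"
  shows "mat_kernel (hessian \<eta> a Q) = span {1}"
proof (intro equalityI subsetI)
  fix x assume "x \<in> mat_kernel (hessian \<eta> a Q)"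
  then have "x \<bullet> (hessian \<eta> a Q *v x) = 0"
    by (simp add: mat_kernel_def)
  then have "(\<Sum>i\<in>UNIV. a $ i * (\<Sum>j\<in>UNIV. Q $ i $ j * (x $ j - (Q *v x) $ i)\<^sup>2)) = 0"
    using \<eta> by (simp add: inner_hessian[OF row])
  \<comment> \<open>A vanishing sum of nonnegative terms has only zero terms. Row
    \<open>i\<^sub>0\<close> is the one to select, because its weights are all strictly positive and
    can be cancelled afterwards.\<close>
  then have "a $ i\<^sub>0 * (\<Sum>j\<in>UNIV. Q $ i\<^sub>0 $ j * (x $ j - (Q *v x) $ i\<^sub>0)\<^sup>2) = 0"
    by (subst (asm) sum_nonneg_eq_0_iff) (auto intro!: mult_nonneg_nonneg sum_nonneg Q 
      less_imp_le[OF a])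
  then have "(\<Sum>j\<in>UNIV. Q $ i\<^sub>0 $ j * (x $ j - (Q *v x) $ i\<^sub>0)\<^sup>2) = 0"
    using a[of i\<^sub>0] by simp
  then have "Q $ i\<^sub>0 $ j * (x $ j - (Q *v x) $ i\<^sub>0)\<^sup>2 = 0" for j
    by (subst (asm) sum_nonneg_eq_0_iff) (auto intro!: mult_nonneg_nonneg Q)
  then have "x $ j = (Q *v x) $ i\<^sub>0" for j
    using pos[of j] by (metis mult_eq_0_iff less_irrefl power2_eq_square eq_iff_diff_eq_0)
  then have "x = (Q *v x) $ i\<^sub>0 *\<^sub>R 1"
    by (simp add: vec_eq_iff)
  then show "x \<in> span {1}"
    by (metis span_base span_mul singletonI)
next
  fix x :: "real ^ 'n" assume "x \<in> span {1}"
  then obtain c where x: "x = c *\<^sub>R 1"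
    by (auto simp: span_singleton)
  \<comment> \<open>In a zero row the first factor vanishes. In a row of sum one, the average of the
    constant vector is \<open>c\<close> itself, so the second factor does.\<close>
  have residual: "Q $ i $ j * (x $ j - (Q *v x) $ i) = 0" for i j
    using row[of i] by (auto simp: x matrix_vector_mult_def simp flip: sum_distrib_right)
  then show "x \<in> mat_kernel (hessian \<eta> a Q)"
    by (simp only: mat_kernel_def mem_Collect_eq vec_eq_iff hessian_mult_nth mult.assoc residual)
      simp
qed

lemma
  fixes X :: "real ^ 'n ^ 'm"
  assumes "\<And>i j. 0 < X $ i $ j"
  shows plan_pos: "0 < plan C X \<eta> \<gamma> $ i $ j"
    and plan_row_sum: "(\<Sum>j\<in>UNIV. plan C X \<eta> \<gamma> $ i $ j) = 1"
proof -
  \<comment> \<open>Positivity of the row normaliser gives both claims: the quotients are positive,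
    and the normaliser cancels in the row sum.\<close>
  have "0 < (\<Sum>l\<in>UNIV. X $ i $ l * exp ((\<gamma> $ l - C $ i $ l) / \<eta>))"
    using assms by (intro sum_pos) auto
  then show "0 < plan C X \<eta> \<gamma> $ i $ j" "(\<Sum>j\<in>UNIV. plan C X \<eta> \<gamma> $ i $ j) = 1"
    using assms by (auto simp: plan_def simp flip: sum_divide_distrib)
qed

lemma sparsify_nonneg:
  assumes "\<And>i j. 0 \<le> P $ i $ j"
  shows "0 \<le> sparsify i\<^sub>0 \<rho> P $ i $ j"
  using assms by (auto simp: sparsify_def intro!: divide_nonneg_nonneg sum_nonneg)

lemma sparsify_row:
  assumes "(\<Sum>j\<in>UNIV. P $ i\<^sub>0 $ j) = 1"
  shows "(\<forall>j. sparsify i\<^sub>0 \<rho> P $ i $ j = 0) \<or> (\<Sum>j\<in>UNIV. sparsify i\<^sub>0 \<rho> P $ i $ j) = 1"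
proof (cases "i = i\<^sub>0")
  case True
  then show ?thesis using assms by (simp add: sparsify_def)
next
  case False
  \<comment> \<open>If the retained mass is zero, division by zero makes the whole row zero;
    otherwise dividing by it normalises the row to sum one.\<close>
  then show ?thesis
    by (cases "(\<Sum>l\<in>UNIV. P $ i $ l * of_bool (P $ i $ l \<ge> \<rho>)) = 0")
      (simp_all add: sparsify_def flip: sum_divide_distrib)
qed

theorem theorem3p2:
  fixes C X :: "real ^ 'n ^ 'm" and a :: "real ^ 'm" and b \<gamma> :: "real ^ 'n"
    and \<eta> \<rho> :: real and i\<^sub>0 :: 'm and H :: "real ^ 'n ^ 'n"
  assumes "\<And>i j. 0 \<le> C $ i $ j"
    and "\<And>i. 0 < a $ i" and "\<And>j. 0 < b $ j"
    and "(\<Sum>i\<in>UNIV. a $ i) = 1" and "(\<Sum>j\<in>UNIV. b $ j) = 1"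
    and "0 < \<eta>"
    and "\<And>i j. 0 < X $ i $ j"
    and "is_arg_max (($) a) (\<lambda>i. True) i\<^sub>0"
    and "0 \<le> \<rho>"
  defines "H \<equiv> hessian \<eta> a (sparsify i\<^sub>0 \<rho> (plan C X \<eta> \<gamma>))"
  shows "transpose H = H \<and> psd H \<and> mat_kernel H = span {1}"
proof -
  let ?Q = "sparsify i\<^sub>0 \<rho> (plan C X \<eta> \<gamma>)"
  note X = \<open>\<And>i j. 0 < X $ i $ j\<close>
  have nonneg: "0 \<le> ?Q $ i $ j" for i j
    by (intro sparsify_nonneg less_imp_le plan_pos X)
  have row: "(\<forall>j. ?Q $ i $ j = 0) \<or> (\<Sum>j\<in>UNIV. ?Q $ i $ j) = 1" for i
    by (intro sparsify_row plan_row_sum X)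
  \<comment> \<open>This row is exempt from thresholding, so it inherits the positivity of the plan
    for every \<open>\<rho>\<close>.\<close>
  have pos: "0 < ?Q $ i\<^sub>0 $ j" for j
    using plan_pos[of X, OF X] by (simp add: sparsify_def)
  have "psd H"
    unfolding H_def using \<open>\<And>i. 0 < a $ i\<close>
    by (intro psd_hessian \<open>0 < \<eta>\<close> nonneg row less_imp_le)
  moreover have "mat_kernel H = span {1}"
    unfolding H_def by (rule mat_kernel_hessian[OF \<open>0 < \<eta>\<close> \<open>\<And>i. 0 < a $ i\<close> nonneg row pos])
  ultimately show ?thesis
    by (simp add: H_def transpose_hessian)
qed

end
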